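(* For every cardinal $\kappa \leqslant \mathfrak{c}$ of uncountable cofinality and every ordinal $\alpha < \min\{\mathfrak{t}, \mathrm{cf}(\kappa)\}$, $$\begin{pmatrix} \kappa \\ \eta \end{pmatrix} \longrightarrow \begin{pmatrix} \kappa & \alpha \\ \eta & \eta \end{pmatrix}.$$
   Context: An order type is an isomorphism class of linearly ordered sets; ordinals are regarded as order types and cardinals are identified with initial ordinals. $\eta$ is the order type of the rational numbers, $\mathfrak{c}=2^{\aleph_0}$. For order types $\alpha,\beta,\gamma,\delta,\varepsilon,\zeta$, the polarised partition relation $$\begin{pmatrix} \alpha \\ \beta \end{pmatrix} \longrightarrow \begin{pmatrix} \gamma & \varepsilon \\ \delta & \zeta \end{pmatrix}$$ means: for all linearly ordered sets $A$ of order type $\alpha$ and $B$ of order type $\beta$ and every colouring $c\colon A\times B\to\{0,1\}$, either there are $C\subseteq A$ of order type $\gamma$ and $D\subseteq B$ of order type $\delta$ with $c[C\times D]\subseteq\{0\}$, or there are $E\subseteq A$ of order type $\varepsilon$ and $Z\subseteq B$ of order type $\zeta$ with $c[E\times Z]\subseteq\{1\}$ (subsets carry the induced order). A set $x\subseteq\omega$ almost contains $y\subseteq\omega$ if $y\setminus x$ is finite. A tower is a sequence $\langle x_\xi \mid \xi<\alpha\rangle$ of infinite sets of natural numbers such that $x_\gamma$ almost contains $x_\beta$ whenever $\gamma<\beta<\alpha$; it is extendible if there is an infinite set of natural numbers almost contained in every member of it. The tower number $\mathfrak{t}$ is the smallest ordinal $\alpha$ such that not all towers of length $\alpha$ are extendible.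 *)

theory Defs
  imports Complex_Main
begin

unbundle cardinal_syntax

text \<open>
  A linearly ordered set is a reflexive relation \<open>r\<close> with \<open>Linear_order r\<close> and underlying set
  \<open>Field r\<close>; an order type is given by any representative. Ordinals are well-orders
  (\<open>Well_order\<close>) compared by \<open>\<le>o\<close> and \<open><o\<close>; cardinals are initial ordinals (\<open>Card_order\<close>).
  The relation \<open>ordIso\<close> is restricted to well-orders, so it cannot be used for arbitrary order
  types, whereas \<open>iso\<close> is order isomorphism for arbitrary relations (see \<open>iso_iff2\<close>).
\<close>

definition same_order_type :: "'a rel \<Rightarrow> 'b rel \<Rightarrow> bool" where
  "same_order_type r s \<longleftrightarrow> (\<exists>f. iso r s f)"

definition suborder_of_type :: "'a rel \<Rightarrow> 'a set \<Rightarrow> 'b rel \<Rightarrow> bool" where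
  "suborder_of_type r C \<gamma> \<longleftrightarrow> C \<subseteq> Field r \<and> same_order_type (Restr r C) \<gamma>"

definition eta :: "rat rel" where
  "eta = {(p, q). p \<le> q}"

text \<open>
  The polarised partition relation with columns \<open>(\<alpha>, \<beta>)\<close>, \<open>(\<gamma>, \<delta>)\<close> and \<open>(\<epsilon>, \<zeta>)\<close>.
  A definition cannot quantify over types, so the types in which the sets \<open>A\<close> and \<open>B\<close> live are
  parameters; a theorem with \<open>TYPE('a)\<close> and \<open>TYPE('b)\<close> for free \<open>'a\<close> and \<open>'b\<close> covers all of them.
\<close>

definition polarised_partition ::
  "'a itself \<Rightarrow> 'b itself \<Rightarrow> 'c rel \<Rightarrow> 'd rel \<Rightarrow> 'e rel \<Rightarrow> 'f rel \<Rightarrow> 'g rel \<Rightarrow> 'h rel \<Rightarrow> bool" where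
  "polarised_partition TA TB \<alpha> \<beta> \<gamma> \<delta> \<epsilon> \<zeta> \<longleftrightarrow>
    (\<forall>(A :: 'a rel) (B :: 'b rel) (c :: 'a \<times> 'b \<Rightarrow> nat).
      Linear_order A \<and> same_order_type A \<alpha> \<and>
      Linear_order B \<and> same_order_type B \<beta> \<and>
      c ` (Field A \<times> Field B) \<subseteq> {0, 1} \<longrightarrow>
      (\<exists>C D. suborder_of_type A C \<gamma> \<and> suborder_of_type B D \<delta> \<and> c ` (C \<times> D) \<subseteq> {0}) \<or>
      (\<exists>E Z. suborder_of_type A E \<epsilon> \<and> suborder_of_type B Z \<zeta> \<and> c ` (E \<times> Z) \<subseteq> {1}))"

text \<open>
  Cofinal subsets in the usual non-strict sense. The library's \<open>cofinal\<close> asks for strictly larger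
  elements, so that a nonzero finite ordinal would have no cofinal subset at all; the cofinality
  used here is \<open>1\<close> for these.
\<close>

definition cofinal_subset :: "'a set \<Rightarrow> 'a rel \<Rightarrow> bool" where
  "cofinal_subset A r \<longleftrightarrow> A \<subseteq> Field r \<and> (\<forall>a \<in> Field r. \<exists>b \<in> A. (a, b) \<in> r)"

text \<open>The least cardinality of a cofinal subset.\<close>

definition cofinality :: "'a rel \<Rightarrow> 'a rel" where
  "cofinality r =
    (SOME k. (\<exists>A. cofinal_subset A r \<and> k = |A| ) \<and> (\<forall>B. cofinal_subset B r \<longrightarrow> k \<le>o |B| ))"

definition almost_contains :: "nat set \<Rightarrow> nat set \<Rightarrow> bool" where
  "almost_contains x y \<longleftrightarrow> finite (y - x)"

text \<open>Towers are indexed by the elements of a well-order \<open>\<alpha>\<close>; their length is its order type.\<close>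

definition tower :: "'i rel \<Rightarrow> ('i \<Rightarrow> nat set) \<Rightarrow> bool" where
  "tower \<alpha> x \<longleftrightarrow>
    (\<forall>\<xi> \<in> Field \<alpha>. infinite (x \<xi>)) \<and>
    (\<forall>\<gamma> \<beta>. (\<gamma>, \<beta>) \<in> \<alpha> \<and> \<gamma> \<noteq> \<beta> \<longrightarrow> almost_contains (x \<gamma>) (x \<beta>))"

definition extendible :: "'i rel \<Rightarrow> ('i \<Rightarrow> nat set) \<Rightarrow> bool" where
  "extendible \<alpha> x \<longleftrightarrow> (\<exists>y. infinite y \<and> (\<forall>\<xi> \<in> Field \<alpha>. almost_contains (x \<xi>) y))"

definition all_towers_extendible :: "'i rel \<Rightarrow> bool" where
  "all_towers_extendible \<alpha> \<longleftrightarrow> (\<forall>x. tower \<alpha> x \<longrightarrow> extendible \<alpha> x)"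

text \<open>
  The least ordinal for which some tower is not extendible. Well-orders on \<open>nat set\<close> suffice:
  a strictly descending (modulo finite) tower that cannot be prolonged is an injective family in
  \<open>nat set\<close>, so its length, and hence every smaller ordinal, is realised on that type.
\<close>

definition tower_number :: "nat set rel" where
  "tower_number =
    (SOME t. Well_order t \<and> \<not> all_towers_extendible t \<and>
      (\<forall>\<alpha> :: nat set rel. Well_order \<alpha> \<and> \<not> all_towers_extendible \<alpha> \<longrightarrow> t \<le>o \<alpha>))"

end

theory Submission
  imports Defs "HOL-Library.Countable_Set"
begin

text \<open>
  Fix a colouring of \<open>\<kappa> \<times> \<rat>\<close> and let \<open>R \<nu>\<close> be the set of rationals that get colour 1 together
  with \<open>\<nu>\<close>. Call a subset of \<open>\<kappa>\<close> large if it has cardinality \<open>\<kappa>\<close>; since the cofinality of \<open>\<kappa>\<close> is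
  uncountable, a large set cannot be covered by countably many sets that are not large.

  Suppose that there is a dense set \<open>X\<close> of rationals such that \<open>X \<inter> R \<nu>\<close> fails to be dense for a large
  set of \<open>\<nu>\<close>. There are only countably many rational intervals, so a single interval misses
  \<open>X \<inter> R \<nu>\<close> for a large set of \<open>\<nu>\<close>, and this set together with the part of \<open>X\<close> in the interval
  is homogeneous for colour 0 (\<open>ex_homogeneous\<close>). Otherwise every dense \<open>X\<close> stays dense
  after intersection with \<open>R \<nu>\<close>, for all but a non-large set of \<open>\<nu>\<close>. Under this assumption one shows by
  induction on the ordinal \<open>r\<close> (\<open>realisable_below\<close>): every large \<open>A\<close> and every dense \<open>X\<close> contain
  an increasing copy of \<open>r\<close> and a dense set, respectively, with all pairs of colour 1.

  At a successor, one further \<open>\<nu>\<close> is chosen such that \<open>R \<nu>\<close> keeps the dense set dense. At a limit,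
  copies of smaller ordinals are placed one above the other, with shrinking dense sets \<open>D\<close>, and the
  problem is to find a dense set that lies in all of them. There are two cases.

  If \<open>r\<close> has countable cofinality, there are countably many blocks. Between the blocks one fixes, one
  at a time, the points of the final dense set, and promises that all later \<open>\<nu>\<close> have these points in
  \<open>R \<nu>\<close>; each point can be chosen so that the set of admissible \<open>\<nu>\<close> remains large
  (\<open>large_point\<close>, \<open>realisable_of_countable_cofinal\<close>).

  If \<open>r\<close> has uncountable cofinality, there is one block for each element of \<open>r\<close>, and the
  dense sets only decrease modulo finite sets; because \<open>r\<close> is below the tower number, such sequences of
  dense sets have dense pseudo-intersections (\<open>dense_pseudo_intersection\<close>). The last
  pseudo-intersection \<open>E\<close> differs from a subset of each \<open>D\<close> by a finite set. There are countably many
  finite sets of rationals, so one of them, \<open>G\<close>, is the difference for a cofinal set of blocks.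
  The dense set \<open>E - G\<close> and the union of suitable parts of these blocks are as required
  (\<open>realisable_of_uncountable_cofinality\<close>). It is essential that every block contains a copy of a
  whole initial segment of \<open>r\<close>: after all other blocks are discarded the rest still has
  type \<open>r\<close>. With single elements for blocks this would fail, as an ordinal \<open>r\<close> may be a
  union of countably many sets of smaller order type even if its cofinality is uncountable.
\<close>

section \<open>Order types and strictly increasing maps\<close>

definition strictly_increasing :: "'a rel \<Rightarrow> 'b rel \<Rightarrow> ('a \<Rightarrow> 'b) \<Rightarrow> bool" where
  "strictly_increasing r s f \<longleftrightarrow>
    f ` Field r \<subseteq> Field s \<and> (\<forall>a b. a \<in> underS r b \<longrightarrow> f a \<in> underS s (f b))"

lemma strictly_increasing_comp:
  assumes "strictly_increasing r s f" and "strictly_increasing s t g"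
  shows "strictly_increasing r t (g \<circ> f)"
  using assms unfolding strictly_increasing_def by (simp add: image_subset_iff)

text \<open>
  Between linear orders a strictly increasing map is an isomorphism onto its image. Sets of a
  given order type are therefore always produced below as images of such maps.
\<close>

lemma suborder_of_type_image:
  assumes r: "Linear_order r" and s: "Linear_order s" and f: "strictly_increasing s r f"
  shows "suborder_of_type r (f ` Field s) s"
proof -
  have sub: "f ` Field s \<subseteq> Field r" using f by (auto simp: strictly_increasing_def)
  have refl: "\<And>x. x \<in> Field r \<Longrightarrow> (x, x) \<in> r" "\<And>x. x \<in> Field s \<Longrightarrow> (x, x) \<in> s"
    using r s by (auto simp: order_on_defs refl_on_def)
  have tot: "\<And>a b. \<lbrakk>a \<in> Field s; b \<in> Field s; a \<noteq> b\<rbrakk> \<Longrightarrow> (a, b) \<in> s \<or> (b, a) \<in> s"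
    using s by (auto simp: order_on_defs total_on_def)
  have anti: "\<And>x y. \<lbrakk>(x, y) \<in> r; (y, x) \<in> r\<rbrakk> \<Longrightarrow> x = y"
    using r by (auto simp: order_on_defs antisym_def)
  have inc: "\<And>a b. \<lbrakk>(a, b) \<in> s; a \<noteq> b\<rbrakk> \<Longrightarrow> (f a, f b) \<in> r \<and> f a \<noteq> f b"
    using f by (auto simp: strictly_increasing_def underS_def)
  have inj: "inj_on f (Field s)"
    by (rule inj_onI) (metis inc tot)
  have iff: "(a, b) \<in> s \<longleftrightarrow> (f a, f b) \<in> r" if "a \<in> Field s" "b \<in> Field s" for a b
    using that by (metis anti inc refl sub image_subset_iff tot)
  have FR: "Field (Restr r (f ` Field s)) = f ` Field s"
    using sub refl(1) by (intro Refl_Field_Restr2) (auto simp: refl_on_def)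
  define g where "g = inv_into (Field s) f"
  have "iso (Restr r (f ` Field s)) s g"
    unfolding iso_iff2 FR
  proof (intro conjI ballI)
    show "bij_betw g (f ` Field s) (Field s)"
      unfolding g_def using inj by (simp add: bij_betw_inv_into inj_on_imp_bij_betw)
    show "(x, y) \<in> Restr r (f ` Field s) \<longleftrightarrow> (g x, g y) \<in> s"
      if "x \<in> f ` Field s" "y \<in> f ` Field s" for x y
      using that iff inj by (auto simp: g_def)
  qed
  then show ?thesis
    using sub by (auto simp: suborder_of_type_def same_order_type_def)
qed

lemma iso_inverse_strictly_increasing:
  assumes "iso r s f"
  shows "strictly_increasing s r (inv_into (Field r) f)"
proof -
  have b: "bij_betw f (Field r) (Field s)"
    and c: "\<And>a b. \<lbrakk>a \<in> Field r; b \<in> Field r\<rbrakk> \<Longrightarrow> (a, b) \<in> r \<longleftrightarrow> (f a, f b) \<in> s"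
    using assms by (auto simp: iso_iff2)
  let ?g = "inv_into (Field r) f"
  have g: "?g x \<in> Field r" "f (?g x) = x" if "x \<in> Field s" for x
    using that b by (auto simp: bij_betw_def inv_into_into f_inv_into_f)
  have "?g a \<in> underS r (?g b)" if "a \<in> underS s b" for a b
    using that g[of a] g[of b] c[of "?g a" "?g b"] by (auto simp: underS_def FieldI1 FieldI2)
  then show ?thesis
    using g by (auto simp: strictly_increasing_def)
qed

lemma in_eta_iff [simp]: "(p, q) \<in> eta \<longleftrightarrow> p \<le> q"
  by (simp add: eta_def)

lemma Field_eta [simp]: "Field eta = UNIV"
  using in_eta_iff by (auto intro: FieldI1)

lemma Linear_order_eta: "Linear_order eta"
  by (auto simp: order_on_defs refl_on_def total_on_def intro!: transI antisymI)

lemma strictly_increasing_eta: "strictly_increasing eta eta e \<longleftrightarrow> strict_mono e"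
  by (auto simp: strictly_increasing_def underS_def strict_mono_def order.strict_iff_order)

section \<open>Dense sets of rationals\<close>

definition rat_dense :: "rat set \<Rightarrow> bool" where
  "rat_dense X \<longleftrightarrow> (\<forall>a b. a < b \<longrightarrow> (\<exists>x\<in>X. a < x \<and> x < b))"

lemma rat_dense_Diff_finite:
  assumes X: "rat_dense X" and F: "finite F"
  shows "rat_dense (X - F)"
  unfolding rat_dense_def
proof (intro allI impI)
  fix a b :: rat assume ab: "a < b"
  define c where "c = Min (insert b {x \<in> F. a < x})"
  have fin: "finite (insert b {x \<in> F. a < x})" using F by auto
  have "a < c" unfolding c_def using fin ab by (subst Min_gr_iff) auto
  then obtain x where x: "x \<in> X" "a < x" "x < c" using X unfolding rat_dense_def by blast
  have "c \<le> b" unfolding c_def using fin by (intro Min_le) auto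
  moreover have "x \<notin> F" using x fin unfolding c_def by auto
  ultimately show "\<exists>x\<in>X - F. a < x \<and> x < b" using x by force
qed

definition rat_interval :: "nat \<Rightarrow> rat set" where
  "rat_interval = from_nat_into {{a<..<b} | a b. a < b}"

lemma range_rat_interval: "range rat_interval = {{a<..<b} | (a :: rat) b. a < b}"
proof -
  have "{{a<..<b} | (a :: rat) b. a < b} \<subseteq> range (\<lambda>(a, b). {a<..<b})" by auto
  then have "countable {{a<..<b} | (a :: rat) b. a < b}"
    by (rule countable_subset) simp
  moreover have "{{a<..<b} | (a :: rat) b. a < b} \<noteq> {}"
    using zero_less_one by blast
  ultimately show ?thesis
    unfolding rat_interval_def by (intro range_from_nat_into)
qed

lemma rat_dense_iff: "rat_dense X \<longleftrightarrow> (\<forall>n. X \<inter> rat_interval n \<noteq> {})"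
proof -
  have "(\<forall>n. X \<inter> rat_interval n \<noteq> {}) \<longleftrightarrow> (\<forall>J\<in>range rat_interval. X \<inter> J \<noteq> {})" by blast
  also have "\<dots> \<longleftrightarrow> (\<forall>a b. a < b \<longrightarrow> X \<inter> {a<..<b} \<noteq> {})"
    unfolding range_rat_interval by blast
  also have "\<dots> \<longleftrightarrow> rat_dense X"
    unfolding rat_dense_def by (simp add: set_eq_iff Bex_def conj_ac)
  finally show ?thesis ..
qed

text \<open>
  The forth half of Cantor's back-and-forth argument: the images of the rationals
  are chosen one after the other along an enumeration. Hence a set that is dense in some
  interval has a subset of type \<open>\<eta>\<close>.
\<close>

lemma ex_strict_mono_into_dense:
  assumes D: "\<And>a b. \<lbrakk>l \<le> a; a < b; b \<le> u\<rbrakk> \<Longrightarrow> \<exists>x\<in>D. a < x \<and> x < b" and "l < u"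
  shows "\<exists>e :: rat \<Rightarrow> rat. strict_mono e \<and> range e \<subseteq> D"
proof -
  define q where "q = (from_nat_into UNIV :: nat \<Rightarrow> rat)"
  have q: "range q = UNIV" "inj q"
    using bij_betw_from_nat_into[of "UNIV :: rat set"] infinite_UNIV_char_0
    by (auto simp: q_def bij_betw_def)
  define good where "good n v \<longleftrightarrow>
      (\<forall>i<n. v i \<in> D \<and> l < v i \<and> v i < u) \<and> (\<forall>i<n. \<forall>j<n. q i < q j \<longrightarrow> v i < (v j :: rat))" for n v
  have good_0: "good 0 v" for v by (simp add: good_def)
  \<comment> \<open>The image of \<open>q n\<close> goes between the images of its neighbours among the earlier rationals.\<close>
  have "\<exists>w. good (Suc n) w \<and> (\<forall>i<n. w i = v i)" if v: "good n v" for n v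
  proof -
    define a where "a = Max (insert l (v ` {i. i < n \<and> q i < q n}))"
    define b where "b = Min (insert u (v ` {i. i < n \<and> q n < q i}))"
    have fin: "finite (insert l (v ` {i. i < n \<and> q i < q n}))" "finite (insert u (v ` {i. i < n \<and> q n < q i}))"
      by auto
    have "l \<le> a" unfolding a_def using fin by (intro Max_ge) auto
    moreover have "b \<le> u" unfolding b_def using fin by (intro Min_le) auto
    moreover have "a < b"
      unfolding a_def b_def using fin v \<open>l < u\<close>
      apply (subst Max_less_iff, simp, simp)
      apply (subst Min_gr_iff, simp, simp)
      unfolding good_def by (auto intro: less_trans)
    ultimately obtain x where x: "x \<in> D" "a < x" "x < b" using D by blast
    have lo: "v i < x" if "i < n" "q i < q n" for i
      using x(2) fin that unfolding a_def by (subst (asm) Max_less_iff) auto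
    have hi: "x < v i" if "i < n" "q n < q i" for i
      using x(3) fin that unfolding b_def by (subst (asm) Min_gr_iff) auto
    have "good (Suc n) (v(n := x))"
      using v x lo hi \<open>l \<le> a\<close> \<open>b \<le> u\<close> unfolding good_def by (auto simp: less_Suc_eq)
    then show ?thesis by (intro exI[of _ "v(n := x)"]) auto
  qed
  then have "\<exists>V. \<forall>n. good n (V n) \<and> (\<forall>i<n. V (Suc n) i = V n i)"
    using good_0 by (intro dependent_nat_choice) blast+
  then obtain V where V: "\<And>n. good n (V n)" "\<And>n i. i < n \<Longrightarrow> V (Suc n) i = V n i"
    by blast
  define v where "v i = V (Suc i) i" for i
  have "V n i = v i" if "i < n" for n i
    using that
  proof (induction n)
    case (Suc n)
    then show ?case using V(2)[of i n] by (cases "i = n") (auto simp: v_def)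
  qed simp
  then have v: "v i \<in> D" "q i < q j \<Longrightarrow> v i < v j" for i j
    using V(1)[of "Suc (max i j)"] unfolding good_def by (auto simp: less_Suc_eq_le)
  define e where "e x = v (inv q x)" for x
  have "strict_mono e"
    unfolding strict_mono_def e_def using v(2) q(1) by (simp add: f_inv_into_f)
  moreover have "range e \<subseteq> D" using v(1) by (auto simp: e_def)
  ultimately show ?thesis by blast
qed

section \<open>Towers and pseudo-intersections of dense sets\<close>

text \<open>
  A well-order \<open>r\<close> below the tower number is isomorphic to an initial segment of it, hence to a
  well-order \<open>s\<close> on \<open>nat set\<close>. If some tower of length \<open>s\<close> were not extendible, the choice in the definition
  of the tower number would be a choice from a nonempty collection, and minimality would give
  the contradiction that the tower number is at most \<open>s\<close>.
\<close>

lemma all_towers_extendible_below_tower_number: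
  assumes "r <o tower_number"
  shows "all_towers_extendible r"
proof -
  let ?bad = "{s :: nat set rel. Well_order s \<and> \<not> all_towers_extendible s}"
  have wr: "Well_order r" and wt: "Well_order tower_number"
    using assms by (auto simp: ordLess_def)
  then obtain a where a: "r =o Restr tower_number (underS tower_number a)"
    and "a \<in> Field tower_number"
    using assms ordLess_iff_ordIso_Restr by blast
  define s where "s = Restr tower_number (underS tower_number a)"
  have s: "s <o tower_number"
    unfolding s_def using \<open>a \<in> Field tower_number\<close> by (intro underS_Restr_ordLess wt) auto
  have ws: "Well_order s" using s by (auto simp: ordLess_def)
  have ext: "all_towers_extendible s"
  proof (rule ccontr)
    assume "\<not> all_towers_extendible s"
    with ws have s_bad: "s \<in> ?bad" by blast
    then have "\<exists>t\<in>?bad. \<forall>u\<in>?bad. t \<le>o u"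
      by (intro exists_minim_Well_order) auto
    then have "\<exists>t :: nat set rel. Well_order t \<and> \<not> all_towers_extendible t \<and>
        (\<forall>u :: nat set rel. Well_order u \<and> \<not> all_towers_extendible u \<longrightarrow> t \<le>o u)"
      by simp
    from someI_ex[OF this] have "tower_number \<le>o s"
      unfolding tower_number_def using s_bad by simp
    with s show False using not_ordLess_ordLeq by blast
  qed
  obtain f where f: "iso r s f"
    using a unfolding s_def ordIso_def by blast
  define g where "g = inv_into (Field r) f"
  have bij: "bij_betw f (Field r) (Field s)" using f by (simp add: iso_iff2)
  have g: "strictly_increasing s r g"
    unfolding g_def by (rule iso_inverse_strictly_increasing[OF f])
  have gf: "g (f i) = i" "f i \<in> Field s" if "i \<in> Field r" for i
    using bij that by (auto simp: g_def bij_betw_def)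
  show ?thesis
    unfolding all_towers_extendible_def
  proof (intro allI impI)
    fix x assume x: "tower r x"
    have "tower s (x \<circ> g)"
      using x g unfolding tower_def strictly_increasing_def underS_def by (auto simp: image_subset_iff)
    then have "extendible s (x \<circ> g)" using ext by (simp add: all_towers_extendible_def)
    then show "extendible r x" using gf unfolding extendible_def by (metis comp_apply)
  qed
qed

text \<open>
  Towers may consist of subsets of any countable set instead of the natural numbers. Nonemptiness of the index
  set makes sure that almost all elements of the pseudo-intersection are codes.
\<close>

lemma countable_pseudo_intersection:
  fixes W :: "'i \<Rightarrow> 'a :: countable set"
  assumes r: "all_towers_extendible r" and ne: "Field r \<noteq> {}"
    and inf: "\<And>i. i \<in> Field r \<Longrightarrow> infinite (W i)"
    and dec: "\<And>i j. i \<in> underS r j \<Longrightarrow> finite (W j - W i)"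
  shows "\<exists>Y. infinite Y \<and> (\<forall>i\<in>Field r. finite (Y - W i))"
proof -
  have "tower r (\<lambda>i. to_nat ` W i)"
    unfolding tower_def almost_contains_def
  proof (intro conjI ballI allI impI)
    show "infinite (to_nat ` W i)" if "i \<in> Field r" for i
      using inf[OF that] by (simp add: finite_image_iff)
    show "finite (to_nat ` W j - to_nat ` W i)" if "(i, j) \<in> r \<and> i \<noteq> j" for i j
    proof -
      have "finite (W j - W i)" using that by (intro dec) (auto simp: underS_def)
      then show ?thesis by (simp flip: image_set_diff[OF inj_to_nat])
    qed
  qed
  with r have "extendible r (\<lambda>i. to_nat ` W i)" by (simp add: all_towers_extendible_def)
  then obtain y where y: "infinite y" "\<And>i. i \<in> Field r \<Longrightarrow> finite (y - to_nat ` W i)"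
    unfolding extendible_def almost_contains_def by auto
  define Y where "Y = {a :: 'a. to_nat a \<in> y}"
  have fin: "finite (Y - W i)" if "i \<in> Field r" for i
  proof -
    have "to_nat ` (Y - W i) \<subseteq> y - to_nat ` W i" by (auto simp: Y_def)
    then have "finite (to_nat ` (Y - W i))" using y(2)[OF that] finite_subset by blast
    then show ?thesis by (simp add: finite_image_iff)
  qed
  obtain i where i: "i \<in> Field r" using ne by blast
  have "y \<subseteq> (y - to_nat ` W i) \<union> to_nat ` Y" by (auto simp: Y_def)
  then have "infinite (to_nat ` Y)"
    using y(1) y(2)[OF i] finite_subset by fastforce
  then have "infinite Y" by blast
  with fin show ?thesis by blast
qed

text \<open>
  A dense set \<open>D\<close> has, beyond any number \<open>m\<close> of its enumeration, a finite piece that meets the first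
  \<open>m\<close> rational intervals. A set \<open>x\<close> of natural numbers is sparse for \<open>D\<close> if its gaps
  are so long that between any two of its elements \<open>m < n\<close> there is such a piece. The gaps of \<open>x\<close> thus
  bound the ends of these pieces from above, and the gaps of an almost smaller set
  are eventually at least as long.
\<close>

definition sparse_for :: "nat set \<Rightarrow> rat set \<Rightarrow> bool" where
  "sparse_for x D \<longleftrightarrow> (\<forall>m\<in>x. \<forall>n\<in>x. m < n \<longrightarrow>
     (\<forall>k<m. \<exists>d\<in>D \<inter> rat_interval k. m \<le> to_nat d \<and> to_nat d < n))"

lemma ex_sparse_subset:
  assumes D: "rat_dense D" and y: "infinite y"
  shows "\<exists>x\<subseteq>y. infinite x \<and> sparse_for x D"
proof -
  have "\<exists>d\<in>D \<inter> rat_interval k. m \<le> to_nat d" for k m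
  proof -
    have "finite {d :: rat. to_nat d < m}"
      by (rule finite_imageD[of to_nat]) (auto intro: finite_subset[of _ "{..<m}"] inj_on_subset[OF inj_to_nat])
    then have "rat_dense (D - {d. to_nat d < m})" by (rule rat_dense_Diff_finite[OF D])
    then show ?thesis unfolding rat_dense_iff by (force simp: not_less)
  qed
  then obtain p where p: "\<And>k m. p k m \<in> D \<inter> rat_interval k \<and> m \<le> to_nat (p k m)"
    by metis
  \<comment> \<open>\<open>g m\<close> ends the piece that begins at \<open>m\<close>; the elements of \<open>x\<close> have to grow at least as fast as \<open>g\<close>.\<close>
  define g where "g m = Suc (Max (insert m ((\<lambda>k. to_nat (p k m)) ` {..<m})))" for m
  have g: "to_nat (p k m) < g m" if "k < m" for k m
    unfolding g_def less_Suc_eq_le using that by (intro Max_ge) auto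
  have gm: "m < g m" for m unfolding g_def less_Suc_eq_le by (intro Max_ge) auto
  have "\<exists>n'. n' \<in> y \<and> g n \<le> n'" for n
    using y by (meson infinite_nat_iff_unbounded_le)
  then have "\<exists>z. \<forall>n. z n \<in> y \<and> g (z n) \<le> z (Suc n)"
    using y by (intro dependent_nat_choice) (auto dest: infinite_imp_nonempty)
  then obtain z where z: "\<And>n. z n \<in> y" "\<And>n. g (z n) \<le> z (Suc n)" by blast
  have mono: "strict_mono z"
    using z(2) gm by (intro strict_mono_Suc_iff[THEN iffD2]) (meson order_less_le_trans)
  have "sparse_for (range z) D"
    unfolding sparse_for_def
  proof (intro ballI impI allI)
    fix m n k assume "m \<in> range z" "n \<in> range z" "m < n" "k < m"
    then obtain a b where ab: "m = z a" "n = z b" "a < b"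
      using mono by (auto simp: strict_mono_less)
    have "g m \<le> n" unfolding ab using z(2)[of a] ab(3) mono
      by (meson Suc_leI order_trans strict_mono_less_eq)
    with p[of k m] g[OF \<open>k < m\<close>] show "\<exists>d\<in>D \<inter> rat_interval k. m \<le> to_nat d \<and> to_nat d < n"
      by (intro bexI[of _ "p k m"]) auto
  qed
  moreover have "infinite (range z)"
    using mono by (simp add: finite_image_iff strict_mono_imp_inj_on)
  ultimately show ?thesis using z(1) by blast
qed

text \<open>
  Pseudo-intersections of the sets \<open>D i \<inter> rat_interval k\<close>, one for each \<open>k\<close>, would not suffice, since
  infinitely many finite errors can add up to an infinite one. Instead, the tower property is used
  twice. A pseudo-intersection \<open>y\<close> of the sparse sets gives a function \<open>h\<close> such that, for every \<open>i\<close> and almost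
  all \<open>m \<in> y\<close>, the points of \<open>D i\<close> with numbers from \<open>m\<close> to below \<open>h m\<close> meet the first \<open>m\<close>
  intervals. Then \<open>W i\<close> consists of the lists of \<open>m\<close> points of \<open>D i\<close> that witness this for
  some \<open>m\<close>. For each \<open>m\<close> there are only finitely many possible lists because of the bound \<open>h m\<close>, and
  long lists consist of points with large numbers, which avoid any given finite set. Therefore the sets \<open>W i\<close>
  form a tower. The points on infinitely many lists make up a dense set because the length
  of the lists is unbounded.
\<close>

lemma dense_pseudo_intersection:
  assumes r: "all_towers_extendible r" and ne: "Field r \<noteq> {}"
    and D: "\<And>i. i \<in> Field r \<Longrightarrow> rat_dense (D i)"
    and x: "\<And>i. i \<in> Field r \<Longrightarrow> infinite (x i)"
    and sp: "\<And>i. i \<in> Field r \<Longrightarrow> sparse_for (x i) (D i)"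
    and dec: "\<And>i j. i \<in> underS r j \<Longrightarrow> finite (D j - D i) \<and> finite (x j - x i)"
  shows "\<exists>E y. rat_dense E \<and> infinite y \<and> (\<forall>i\<in>Field r. finite (E - D i) \<and> finite (y - x i))"
proof -
  have "\<exists>y. infinite y \<and> (\<forall>i\<in>Field r. finite (y - x i))"
    using x dec by (intro countable_pseudo_intersection r ne) auto
  then obtain y where y: "infinite y" "\<And>i. i \<in> Field r \<Longrightarrow> finite (y - x i)"
    by auto
  define h where "h m = (LEAST n. n \<in> y \<and> m < n)" for m
  have h: "h m \<in> y" "m < h m" for m
    using y(1) LeastI_ex[of "\<lambda>n. n \<in> y \<and> m < n"] unfolding h_def
    by (meson infinite_nat_iff_unbounded)+
  define good where "good s \<longleftrightarrow> length s \<in> y \<and> (\<forall>k<length s. s ! k \<in> rat_interval k \<and>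
      length s \<le> to_nat (s ! k) \<and> to_nat (s ! k) < h (length s))" for s
  define W where "W i = {s. good s \<and> set s \<subseteq> D i}" for i
  have fin_idx: "finite {d :: rat. to_nat d < m}" for m
    by (rule finite_imageD[of to_nat])
      (auto intro: finite_subset[of _ "{..<m}"] inj_on_subset[OF inj_to_nat])
  have fin_len: "finite {s. good s \<and> length s \<le> N}" for N
  proof (rule finite_subset)
    show "{s. good s \<and> length s \<le> N} \<subseteq>
        (\<Union>m\<le>N. {s. set s \<subseteq> {d. to_nat d < h m} \<and> length s = m})"
      by (auto simp: good_def in_set_conv_nth)
    show "finite (\<Union>m\<le>N. {s. set s \<subseteq> {d :: rat. to_nat d < h m} \<and> length s = m})"
      using fin_idx by (auto intro: finite_lists_length_eq)
  qed
  have inf_W: "infinite (W i)" if i: "i \<in> Field r" for i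
  proof
    assume "finite (W i)"
    then obtain M where M: "length ` W i \<union> (y - x i) \<subseteq> {..M}"
      using y(2)[OF i] by (meson finite_UnI finite_imageI finite_nat_iff_bounded_le)
    obtain m where m: "m \<in> y" "M < m" using y(1) infinite_nat_iff_unbounded by blast
    \<comment> \<open>Beyond \<open>M\<close>, both \<open>m\<close> and its successor \<open>h m\<close> in \<open>y\<close> are elements of \<open>x i\<close>, so sparseness applies to them.\<close>
    have "m \<in> x i" using m M by auto
    moreover have "h m \<in> x i" using m M h[of m] by auto
    ultimately have "\<forall>k<m. \<exists>d. d \<in> D i \<inter> rat_interval k \<and> m \<le> to_nat d \<and> to_nat d < h m"
      using sp[OF i] h(2)[of m] unfolding sparse_for_def by blast
    then obtain d where d: "\<And>k. k < m \<Longrightarrow> d k \<in> D i \<inter> rat_interval k \<and> m \<le> to_nat (d k) \<and> to_nat (d k) < h m"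
      by metis
    have "map d [0..<m] \<in> W i"
      using d m by (auto simp: W_def good_def)
    then have "length (map d [0..<m]) \<le> M" using M by blast
    with m show False by simp
  qed
  have dec_W: "finite (W j - W i)" if "i \<in> underS r j" for i j
  proof -
    have "finite (to_nat ` (D j - D i))" using dec[OF that] by blast
    then obtain N where N: "to_nat ` (D j - D i) \<subseteq> {..<N}" using finite_nat_iff_bounded by blast
    have "W j - W i \<subseteq> {s. good s \<and> length s \<le> N}"
    proof
      fix s assume s: "s \<in> W j - W i"
      then obtain k where k: "k < length s" "s ! k \<in> D j - D i"
        by (auto simp: W_def in_set_conv_nth subset_iff)
      then have "to_nat (s ! k) < N" using N by blast
      moreover have "length s \<le> to_nat (s ! k)" using s k by (auto simp: W_def good_def)
      ultimately show "s \<in> {s. good s \<and> length s \<le> N}" using s by (auto simp: W_def)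
    qed
    then show ?thesis using fin_len finite_subset by blast
  qed
  have "\<exists>Y. infinite Y \<and> (\<forall>i\<in>Field r. finite (Y - W i))"
    using inf_W dec_W by (intro countable_pseudo_intersection r ne) auto
  then obtain Y where Y: "infinite Y" "\<And>i. i \<in> Field r \<Longrightarrow> finite (Y - W i)"
    by auto
  obtain i where i: "i \<in> Field r" using ne by blast
  \<comment> \<open>Finitely many elements of \<open>Y\<close> may be lists of a wrong form.\<close>
  define Z where "Z = Y \<inter> W i"
  have inf_Z: "infinite Z"
    using Y(1) Y(2)[OF i] unfolding Z_def by (metis Diff_Diff_Int Diff_infinite_finite)
  define E where "E = \<Union> (set ` Z)"
  have "E \<inter> rat_interval k \<noteq> {}" for k
  proof -
    have "\<not> Z \<subseteq> {s. good s \<and> length s \<le> k}" using inf_Z fin_len finite_subset by blast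
    then obtain s where "s \<in> Z" "\<not> (good s \<and> length s \<le> k)" by blast
    then have s: "s \<in> Z" "good s" "k < length s" by (auto simp: Z_def W_def)
    then have "s ! k \<in> E \<inter> rat_interval k" using nth_mem unfolding good_def E_def by blast
    then show ?thesis by blast
  qed
  then have "rat_dense E" by (simp add: rat_dense_iff)
  moreover have "finite (E - D j)" if j: "j \<in> Field r" for j
  proof (rule finite_subset)
    show "E - D j \<subseteq> \<Union> (set ` (Y - W j))" by (auto simp: E_def Z_def W_def)
    show "finite (\<Union> (set ` (Y - W j)))" using Y(2)[OF j] by auto
  qed
  ultimately show ?thesis using y by blast
qed

text \<open>
  The form needed in the recursion of length \<open>r\<close>: the empty sequence is allowed, and the new dense set stays
  inside a set \<open>X\<close> that contains the whole sequence.
\<close>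

lemma dense_pseudo_intersection_within:
  assumes r: "all_towers_extendible r" and X: "rat_dense X"
    and D: "\<And>i. i \<in> Field r \<Longrightarrow> rat_dense (D i) \<and> D i \<subseteq> X"
    and x: "\<And>i. i \<in> Field r \<Longrightarrow> infinite (x i) \<and> sparse_for (x i) (D i)"
    and dec: "\<And>i j. i \<in> underS r j \<Longrightarrow> finite (D j - D i) \<and> finite (x j - x i)"
  shows "\<exists>E y. rat_dense E \<and> E \<subseteq> X \<and> infinite y \<and> (\<forall>i\<in>Field r. finite (E - D i) \<and> finite (y - x i))"
proof (cases "Field r = {}")
  case True
  then show ?thesis
    using X by (intro exI[of _ X] exI[of _ "UNIV :: nat set"]) simp
next
  case False
  then obtain i where i: "i \<in> Field r" by blast
  have "\<exists>E y. rat_dense E \<and> infinite y \<and> (\<forall>i\<in>Field r. finite (E - D i) \<and> finite (y - x i))"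
    using D x dec False by (intro dense_pseudo_intersection r) auto
  then obtain E y where E: "rat_dense E" "infinite y"
    and Ey: "\<And>i. i \<in> Field r \<Longrightarrow> finite (E - D i) \<and> finite (y - x i)" by auto
  have "E - X \<subseteq> E - D i" using D[OF i] by blast
  then have "finite (E - X)" using Ey[OF i] finite_subset by blast
  then have "rat_dense (E - (E - X))" by (rule rat_dense_Diff_finite[OF E(1)])
  moreover have "finite (E - (E - X) - D j)" if "j \<in> Field r" for j
    using Ey[OF that] by (auto intro: finite_subset[of _ "E - D j"])
  ultimately show ?thesis
    using E(2) Ey by (intro exI[of _ "E - (E - X)"] exI[of _ y]) auto
qed

section \<open>Large subsets of a cardinal of uncountable cofinality\<close>

lemma cofinality_ordLeq:
  assumes "cofinal_subset B r"
  shows "cofinality r \<le>o |B|"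
proof -
  let ?R = "{|A| | A. cofinal_subset A r}"
  have "\<exists>k\<in>?R. \<forall>k'\<in>?R. k \<le>o k'"
    using assms by (intro exists_minim_Well_order) (auto intro: card_of_Well_order)
  then have "\<exists>k. (\<exists>A. cofinal_subset A r \<and> k = |A| ) \<and> (\<forall>B. cofinal_subset B r \<longrightarrow> k \<le>o |B| )"
    by blast
  from someI_ex[OF this] show ?thesis
    unfolding cofinality_def using assms by simp
qed

lemma embed_strictly_increasing:
  assumes r: "Well_order r" and f: "embed r s f"
  shows "strictly_increasing r s f"
  unfolding strictly_increasing_def
proof (intro conjI allI impI)
  show "f ` Field r \<subseteq> Field s" by (rule embed_Field[OF f])
  show "f a \<in> underS s (f b)" if "a \<in> underS r b" for a b
  proof -
    have "b \<in> Field r" using that by (auto simp: underS_def FieldI2)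
    then have "bij_betw f (underS r b) (underS s (f b))" by (rule embed_underS[OF r f])
    then show ?thesis using that by (auto simp: bij_betw_def)
  qed
qed

locale uncountable_cofinality =
  fixes \<kappa> :: "'k rel"
  assumes card: "Card_order \<kappa>" and cof: "natLeq <o cofinality \<kappa>"
begin

lemma well: "Well_order \<kappa>"
  using card by (simp add: card_order_on_def)

lemma wo: "wo_rel \<kappa>"
  using well by (simp add: wo_rel_def)

lemma underS_trans: "a \<in> underS \<kappa> b \<Longrightarrow> b \<in> underS \<kappa> c \<Longrightarrow> a \<in> underS \<kappa> c"
  using wo_rel.TRANS[OF wo] wo_rel.ANTISYM[OF wo]
  unfolding underS_def trans_def antisym_def by blast

lemma underS_total: "a \<in> Field \<kappa> \<Longrightarrow> b \<in> Field \<kappa> \<Longrightarrow> a \<in> underS \<kappa> b \<or> a = b \<or> b \<in> underS \<kappa> a"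
  using wo_rel.TOTALS[OF wo] unfolding underS_def by blast

lemma infinite_Field: "infinite (Field \<kappa>)"
proof -
  have "cofinal_subset (Field \<kappa>) \<kappa>"
    using wo_rel.REFL[OF wo] by (auto simp: cofinal_subset_def refl_on_def)
  then have "natLeq \<le>o |Field \<kappa>|"
    using cof cofinality_ordLeq ordLess_ordLeq_trans ordLess_imp_ordLeq by blast
  then show ?thesis using infinite_iff_natLeq_ordLeq by blast
qed

text \<open>
  The bound is strict: an element of \<open>\<kappa>\<close> that witnesses that \<open>B\<close> is not cofinal is not below any element
  of \<open>B\<close>, hence strictly above all of them.
\<close>

lemma bounded:
  assumes B: "B \<subseteq> Field \<kappa>" and small: "|B| <o cofinality \<kappa>"
  shows "\<exists>u\<in>Field \<kappa>. B \<subseteq> underS \<kappa> u"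
proof -
  have "\<not> cofinal_subset B \<kappa>"
    using small cofinality_ordLeq not_ordLess_ordLeq by blast
  then obtain u where "u \<in> Field \<kappa>" "\<And>b. b \<in> B \<Longrightarrow> (u, b) \<notin> \<kappa>"
    using B unfolding cofinal_subset_def by blast
  moreover from this have "b \<in> underS \<kappa> u" if "b \<in> B" for b
    using underS_total[of b u] wo_rel.REFL[OF wo] B that
    unfolding underS_def refl_on_def by blast
  ultimately show ?thesis by blast
qed

lemma bounded_countable:
  assumes B: "B \<subseteq> Field \<kappa>" and "countable B"
  shows "\<exists>u\<in>Field \<kappa>. B \<subseteq> underS \<kappa> u"
proof (rule bounded[OF B])
  have "|B| \<le>o natLeq"
    using \<open>countable B\<close> by (meson card_of_nat card_of_ordLeqI countableE UNIV_I ordLeq_ordIso_trans)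
  then show "|B| <o cofinality \<kappa>" using cof ordLeq_ordLess_trans by blast
qed

lemma bounded_image:
  assumes r: "r <o cofinality \<kappa>" and S: "S \<subseteq> Field r" and f: "f ` S \<subseteq> Field \<kappa>"
  shows "\<exists>u\<in>Field \<kappa>. f ` S \<subseteq> underS \<kappa> u"
proof (rule bounded[OF f])
  have "|f ` S| \<le>o |S|" by (rule card_of_image)
  also have "|S| \<le>o |Field r|" using S by (rule card_of_mono1)
  also have "|Field r| \<le>o r" using r by (intro card_of_least) (simp add: ordLess_def)
  also have "r <o cofinality \<kappa>" by (rule r)
  finally show "|f ` S| <o cofinality \<kappa>" .
qed

definition large :: "'k set \<Rightarrow> bool" where
  "large A \<longleftrightarrow> A \<subseteq> Field \<kappa> \<and> \<kappa> \<le>o |A|"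

lemma large_subset: "large A \<Longrightarrow> A \<subseteq> Field \<kappa>"
  by (simp add: large_def)

lemma large_Field: "large (Field \<kappa>)"
  using card_of_Field_ordIso[OF card] ordIso_symmetric ordIso_iff_ordLeq
  unfolding large_def by blast

lemma large_mono: "large A \<Longrightarrow> A \<subseteq> B \<Longrightarrow> B \<subseteq> Field \<kappa> \<Longrightarrow> large B"
  unfolding large_def using card_of_mono1 ordLeq_transitive by blast

lemma not_large: "A \<subseteq> Field \<kappa> \<Longrightarrow> \<not> large A \<Longrightarrow> |A| <o \<kappa>"
  unfolding large_def using not_ordLeq_iff_ordLess[OF card_of_Well_order well] by blast

text \<open>
  If no \<open>A \<inter> B i\<close> is large, each of them has at most the cardinality of a proper initial segment. The
  countably many initial segments are bounded by a single \<open>u\<close>, so the cardinality of \<open>A\<close> is at most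
  that of the sum of \<open>\<omega>\<close> and the segment below \<open>u\<close>, which is less than \<open>\<kappa>\<close> since
  \<open>\<kappa>\<close> is uncountable. This works for singular \<open>\<kappa>\<close> as well.
\<close>

lemma large_countable_cover:
  assumes A: "large A" and I: "countable I" and cover: "A \<subseteq> (\<Union>i\<in>I. B i)"
  shows "\<exists>i\<in>I. large (A \<inter> B i)"
proof (rule ccontr)
  assume neg: "\<not> (\<exists>i\<in>I. large (A \<inter> B i))"
  have "\<forall>i\<in>I. \<exists>a\<in>Field \<kappa>. |A \<inter> B i| \<le>o |underS \<kappa> a|"
  proof
    fix i assume "i \<in> I"
    then have "|A \<inter> B i| <o \<kappa>" using neg large_subset[OF A] by (intro not_large) auto
    then obtain a where a: "a \<in> Field \<kappa>" "|A \<inter> B i| =o Restr \<kappa> (underS \<kappa> a)"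
      using ordLess_iff_ordIso_Restr[OF well card_of_Well_order] by blast
    have "|A \<inter> B i| =o |Field (Restr \<kappa> (underS \<kappa> a))|"
      using card_of_cong[OF a(2)] by (simp add: Field_card_of)
    moreover have "|Field (Restr \<kappa> (underS \<kappa> a))| \<le>o |underS \<kappa> a|"
      by (intro card_of_mono1 Field_Restr_subset)
    ultimately show "\<exists>a\<in>Field \<kappa>. |A \<inter> B i| \<le>o |underS \<kappa> a|"
      using a(1) ordIso_ordLeq_trans by blast
  qed
  then obtain a where a: "\<And>i. i \<in> I \<Longrightarrow> a i \<in> Field \<kappa>" "\<And>i. i \<in> I \<Longrightarrow> |A \<inter> B i| \<le>o |underS \<kappa> (a i)|"
    by metis
  have "\<exists>u\<in>Field \<kappa>. a ` I \<subseteq> underS \<kappa> u"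
    using a(1) I by (intro bounded_countable) auto
  then obtain u where u: "u \<in> Field \<kappa>" "a ` I \<subseteq> underS \<kappa> u" by blast
  define U where "U = underS \<kappa> u <+> (UNIV :: nat set)"
  have le_U: "|A \<inter> B i| \<le>o |U|" if "i \<in> I" for i
  proof -
    have "underS \<kappa> (a i) \<subseteq> underS \<kappa> u" using u(2) that underS_trans by blast
    then have "|underS \<kappa> (a i)| \<le>o |underS \<kappa> u|" by (rule card_of_mono1)
    also have "|underS \<kappa> u| \<le>o |U|" unfolding U_def by (rule card_of_Plus1)
    finally show ?thesis using a(2)[OF that] ordLeq_transitive by blast
  qed
  have inf_U: "infinite U" by (simp add: U_def)
  have "|I| \<le>o |UNIV :: nat set|"
    using I by (meson card_of_ordLeqI countableE UNIV_I)
  also have "|UNIV :: nat set| \<le>o |U|" unfolding U_def by (rule card_of_Plus2)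
  finally have "|\<Union>i\<in>I. A \<inter> B i| \<le>o |U|"
    using le_U by (intro card_of_UNION_ordLeq_infinite inf_U) auto
  moreover have "A = (\<Union>i\<in>I. A \<inter> B i)" using cover by blast
  ultimately have "|A| \<le>o |U|" by simp
  moreover have "|U| <o \<kappa>"
    unfolding U_def
  proof (rule card_of_Plus_ordLess_infinite_Field[OF infinite_Field card])
    show "|underS \<kappa> u| <o \<kappa>" by (rule card_of_underS[OF card u(1)])
    have "natLeq <o |Field \<kappa>|"
      using cof cofinality_ordLeq[of "Field \<kappa>" \<kappa>] wo_rel.REFL[OF wo] ordLess_ordLeq_trans
      by (auto simp: cofinal_subset_def refl_on_def)
    then have "natLeq <o \<kappa>" using card_of_Field_ordIso[OF card] ordLess_ordIso_trans by blast
    then show "|UNIV :: nat set| <o \<kappa>" using card_of_nat ordIso_ordLess_trans by blast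
  qed
  ultimately show False
    using A unfolding large_def
    using not_ordLess_ordLeq ordLeq_ordLess_trans by blast
qed

lemma large_Un:
  assumes "large A" and "A \<subseteq> B \<union> C"
  shows "large (A \<inter> B) \<or> large (A \<inter> C)"
  using large_countable_cover[of A "UNIV :: bool set" "\<lambda>b. if b then B else C"] assms
  by (auto simp: UNIV_bool)

lemma large_Diff:
  assumes A: "large A" and N: "N \<subseteq> Field \<kappa>" "\<not> large N"
  shows "large (A - N)"
proof -
  have "large (A \<inter> (A - N)) \<or> large (A \<inter> N)" using A by (intro large_Un) auto
  moreover have "\<not> large (A \<inter> N)" using N large_mono by blast
  ultimately show ?thesis by (simp add: Int_absorb1)
qed

lemma large_tail:
  assumes A: "large A" and u: "u \<in> Field \<kappa>"
  shows "large {\<nu> \<in> A. u \<in> underS \<kappa> \<nu>}"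
proof -
  obtain v where v: "v \<in> Field \<kappa>" "u \<in> underS \<kappa> v"
    using bounded_countable[of "{u}"] u by auto
  have "|underS \<kappa> v| <o \<kappa>" by (rule card_of_underS[OF card v(1)])
  then have "\<not> large (underS \<kappa> v)"
    unfolding large_def using not_ordLess_ordLeq by blast
  then have "large (A - underS \<kappa> v)"
    using A by (intro large_Diff) (auto intro: underS_Field)
  moreover have "u \<in> underS \<kappa> \<nu>" if "\<nu> \<in> A - underS \<kappa> v" for \<nu>
    using that underS_total[of \<nu> v] v large_subset[OF A] underS_trans by blast
  ultimately show ?thesis
    using large_subset[OF A] by (elim large_mono) auto
qed

text \<open>
  A subset of cardinality \<open>\<kappa>\<close> has an order type of at least the initial ordinal \<open>\<kappa>\<close>.
\<close>

lemma large_has_full_type: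
  assumes C: "large C"
  shows "\<exists>g. strictly_increasing \<kappa> \<kappa> g \<and> g ` Field \<kappa> \<subseteq> C"
proof -
  have F: "Field (Restr \<kappa> C) = C"
    using large_subset[OF C] wo_rel.REFL[OF wo] by (intro Refl_Field_Restr2)
  have W: "Well_order (Restr \<kappa> C)" using well by (rule Well_order_Restr)
  have "\<kappa> \<le>o |C|" using C by (simp add: large_def)
  also have "|C| \<le>o Restr \<kappa> C" using W F by (intro card_of_least) simp
  finally obtain g where g: "embed \<kappa> (Restr \<kappa> C) g" by (auto simp: ordLeq_def)
  then have "strictly_increasing \<kappa> (Restr \<kappa> C) g" by (rule embed_strictly_increasing[OF well])
  then show ?thesis
    using large_subset[OF C] unfolding strictly_increasing_def F by (intro exI[of _ g]) (auto simp: underS_def)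
qed

end

section \<open>Initial segments and gluing\<close>

lemma Field_Restr_underS:
  assumes "Well_order r"
  shows "Field (Restr r (underS r a)) = underS r a"
  using assms by (simp add: Field_Restr_ofilter wo_rel.underS_ofilter wo_rel_def)

lemma underS_Restr_underS:
  assumes "Well_order r" and "b \<in> underS r a"
  shows "underS (Restr r (underS r a)) b = underS r b"
proof -
  have "underS r b \<subseteq> underS r a"
    using assms wo_rel.TRANS[of r] wo_rel.ANTISYM[of r]
    unfolding wo_rel_def underS_def trans_def antisym_def by blast
  then show ?thesis using assms(2) by (auto simp: underS_def)
qed

lemma strictly_increasing_Restr_underS:
  assumes "Well_order r"
  shows "strictly_increasing (Restr r (underS r a)) s f \<longleftrightarrow> f ` underS r a \<subseteq> Field s \<and>
    (\<forall>b c. b \<in> underS r c \<and> c \<in> underS r a \<longrightarrow> f b \<in> underS s (f c))"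
proof -
  have "b \<in> underS (Restr r (underS r a)) c \<longleftrightarrow> b \<in> underS r c \<and> c \<in> underS r a" for b c
    using underS_Restr_underS[OF assms, of c a] by (auto simp: underS_def)
  then show ?thesis
    unfolding strictly_increasing_def Field_Restr_underS[OF assms] by auto
qed

text \<open>
  Every element \<open>b\<close> is mapped by the first block whose domain contains it. The index of this block is a
  weakly increasing function of \<open>b\<close>, and so the combined map is strictly increasing. It is enough
  that the domains of the blocks \<open>j \<in> P\<close> cover \<open>r\<close>; this is what permits discarding
  blocks in the case of uncountable cofinality.
\<close>

lemma strictly_increasing_glue:
  assumes r: "Well_order r" and J: "Well_order J" and P: "P \<subseteq> Field J"
    and cover: "\<And>b. b \<in> Field r \<Longrightarrow> \<exists>j\<in>P. b \<in> underS r (k j)"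
    and f: "\<And>j. j \<in> P \<Longrightarrow> strictly_increasing (Restr r (underS r (k j))) s (f j)"
    and step: "\<And>i j b c. \<lbrakk>i \<in> P; j \<in> P; i \<in> underS J j; b \<in> underS r (k i); c \<in> underS r (k j)\<rbrakk>
      \<Longrightarrow> f i b \<in> underS s (f j c)"
  shows "\<exists>F. strictly_increasing r s F \<and> (\<forall>b\<in>Field r. \<exists>j\<in>P. b \<in> underS r (k j) \<and> F b = f j b)"
proof -
  have woJ: "wo_rel J" using J by (simp add: wo_rel_def)
  define S where "S b = {j \<in> P. b \<in> underS r (k j)}" for b
  define i where "i b = wo_rel.minim J (S b)" for b
  have S: "S b \<subseteq> Field J" for b using P by (auto simp: S_def)
  have i: "i b \<in> P" "b \<in> underS r (k (i b))" if "b \<in> Field r" for b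
  proof -
    have "S b \<noteq> {}" using cover[OF that] by (auto simp: S_def)
    then have "i b \<in> S b" unfolding i_def by (rule wo_rel.minim_in[OF woJ S])
    then show "i b \<in> P" "b \<in> underS r (k (i b))" by (auto simp: S_def)
  qed
  define F where "F b = f (i b) b" for b
  have "F b \<in> underS s (F c)" if bc: "b \<in> underS r c" for b c
  proof -
    have F: "b \<in> Field r" "c \<in> Field r" using bc by (auto simp: underS_def FieldI1 FieldI2)
    have "b \<in> underS r (k (i c))"
      using bc i(2)[OF F(2)] r wo_rel.TRANS[of r] wo_rel.ANTISYM[of r]
      unfolding wo_rel_def underS_def trans_def antisym_def by blast
    then have "i c \<in> S b" using i(1)[OF F(2)] by (simp add: S_def)
    then have "(i b, i c) \<in> J" unfolding i_def[of b] by (rule wo_rel.minim_least[OF woJ S])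
    then consider "i b = i c" | "i b \<in> underS J (i c)" by (auto simp: underS_def)
    then show ?thesis
    proof cases
      case 1
      then show ?thesis
        using f[OF i(1)[OF F(2)]] bc i(2)[OF F(2)]
        unfolding F_def by (simp add: strictly_increasing_Restr_underS[OF r])
    next
      case 2
      then show ?thesis unfolding F_def using i F by (intro step)
    qed
  qed
  moreover have "F b \<in> Field s" if "b \<in> Field r" for b
    using f[OF i(1)[OF that]] i(2)[OF that]
    unfolding F_def by (auto simp: strictly_increasing_Restr_underS[OF r])
  ultimately have "strictly_increasing r s F" by (auto simp: strictly_increasing_def)
  then show ?thesis using i unfolding F_def by blast
qed

section \<open>Realising an ordinal in colour 1\<close>

text \<open>
  One step of the constructions at limits: an embedded block, the current dense set and a bound for the
  block in \<open>\<kappa>\<close>. The third component is the set of points fixed so far in the case of countable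
  cofinality, and a sparse set of natural numbers in the case of uncountable cofinality.
\<close>

datatype ('i, 'k, 'x) stage = Stage (emb: "'i \<Rightarrow> 'k") (pts: "rat set") (aux: 'x) (bnd: 'k)

locale no_large_homogeneous = uncountable_cofinality \<kappa> for \<kappa> :: "'k rel" +
  fixes R :: "'k \<Rightarrow> rat set"
  assumes rarely_not_dense: "rat_dense X \<Longrightarrow> \<not> large {\<nu> \<in> Field \<kappa>. \<not> rat_dense (X \<inter> R \<nu>)}"
begin

lemma large_dense:
  assumes "large A" and "rat_dense X"
  shows "large {\<nu> \<in> A. rat_dense (X \<inter> R \<nu>)}"
proof -
  have "large (A - {\<nu> \<in> Field \<kappa>. \<not> rat_dense (X \<inter> R \<nu>)})"
    using assms rarely_not_dense by (intro large_Diff) auto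
  then show ?thesis
    using large_subset[OF assms(1)] by (elim large_mono) auto
qed

lemma large_nonempty: "large A \<Longrightarrow> A \<noteq> {}"
proof
  assume "large A" "A = {}"
  then show False using large_countable_cover[of "{}" "{}"] by auto
qed

text \<open>
  For each of the large set of \<open>\<nu>\<close> for which \<open>X \<inter> R \<nu>\<close> is dense there is a suitable point in the given
  interval; countably many points are available, so one of them serves a large set of \<open>\<nu>\<close>.
\<close>

lemma large_point:
  assumes A: "large A" and X: "rat_dense X"
  shows "\<exists>d\<in>X \<inter> rat_interval n. large {\<nu> \<in> A. d \<in> R \<nu>}"
proof -
  let ?A = "{\<nu> \<in> A. rat_dense (X \<inter> R \<nu>)}"
  have "?A \<subseteq> (\<Union>d\<in>X \<inter> rat_interval n. {\<nu>. d \<in> R \<nu>})"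
    unfolding rat_dense_iff by blast
  then have "\<exists>d\<in>X \<inter> rat_interval n. large (?A \<inter> {\<nu>. d \<in> R \<nu>})"
    using large_dense[OF A X] by (intro large_countable_cover) auto
  then show ?thesis using large_subset[OF A] by (elim bexE) (auto elim!: large_mono)
qed

text \<open>
  Quantifying over all large \<open>A\<close> and all dense \<open>X\<close> makes the induction work: in a limit step
  the induction hypothesis is applied above previous blocks, inside previous dense sets, and, for countable cofinality,
  to those \<open>\<nu>\<close> only that respect the points that have been fixed.
\<close>

definition realisable :: "'i rel \<Rightarrow> bool" where
  "realisable r \<longleftrightarrow> (\<forall>A X. large A \<and> rat_dense X \<longrightarrow>
    (\<exists>f D. strictly_increasing r \<kappa> f \<and> f ` Field r \<subseteq> A \<and> rat_dense D \<and> D \<subseteq> X \<and>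
      (\<forall>a\<in>Field r. D \<subseteq> R (f a))))"

lemma realisableD:
  assumes "realisable r" and "large A" and "rat_dense X"
  shows "\<exists>f D. strictly_increasing r \<kappa> f \<and> f ` Field r \<subseteq> A \<and> rat_dense D \<and> D \<subseteq> X \<and>
    (\<forall>a\<in>Field r. D \<subseteq> R (f a))"
  using assms unfolding realisable_def by simp

definition stage_at :: "'i rel \<Rightarrow> 'k set \<Rightarrow> rat set \<Rightarrow> 'i \<Rightarrow> ('i, 'k, 'x) stage \<Rightarrow> bool" where
  "stage_at r A X a t \<longleftrightarrow>
    strictly_increasing (Restr r (underS r a)) \<kappa> (emb t) \<and> emb t ` underS r a \<subseteq> A \<and>
    rat_dense (pts t) \<and> pts t \<subseteq> X \<and> (\<forall>b\<in>underS r a. pts t \<subseteq> R (emb t b)) \<and>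
    bnd t \<in> Field \<kappa> \<and> emb t ` underS r a \<subseteq> underS \<kappa> (bnd t)"

lemma ex_stage_above:
  assumes r: "Well_order r" and small: "r <o cofinality \<kappa>"
    and real: "realisable (Restr r (underS r a))"
    and A: "large A" and X: "rat_dense X" and u: "u \<in> Field \<kappa>"
  shows "\<exists>f D v. u \<in> underS \<kappa> v \<and> (\<forall>b\<in>underS r a. u \<in> underS \<kappa> (f b)) \<and>
    (\<forall>x :: 'x. stage_at r A X a (Stage f D x v))"
proof -
  from realisableD[OF real large_tail[OF A u] X]
  obtain f D where f: "strictly_increasing (Restr r (underS r a)) \<kappa> f"
    and fA: "f ` underS r a \<subseteq> {\<nu> \<in> A. u \<in> underS \<kappa> \<nu>}"
    and D: "rat_dense D" "D \<subseteq> X" "\<And>b. b \<in> underS r a \<Longrightarrow> D \<subseteq> R (f b)"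
    unfolding Field_Restr_underS[OF r] by auto
  have "\<exists>v\<in>Field \<kappa>. f ` underS r a \<subseteq> underS \<kappa> v"
    using fA large_subset[OF A] by (intro bounded_image[OF small]) (auto intro: underS_Field)
  then obtain w where w: "w \<in> Field \<kappa>" "f ` underS r a \<subseteq> underS \<kappa> w" by blast
  obtain v where v: "v \<in> Field \<kappa>" "u \<in> underS \<kappa> v" "w \<in> underS \<kappa> v"
    using bounded_countable[of "{u, w}"] u w(1) by auto
  have "f ` underS r a \<subseteq> underS \<kappa> v" using w(2) v(3) underS_trans by blast
  then show ?thesis
    using f fA D v unfolding stage_at_def
    by (intro exI[of _ f] exI[of _ D] exI[of _ v]) auto
qed

text \<open>
  The successor step: after a block for the elements below the maximum \<open>a\<close>, all \<open>\<nu>\<close> above the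
  block, up to a set that is not large, are possible images of \<open>a\<close>.
\<close>

lemma realisable_of_maximum:
  assumes r: "Well_order r" and small: "r <o cofinality \<kappa>"
    and a: "a \<in> Field r" "\<And>b. b \<in> Field r \<Longrightarrow> (b, a) \<in> r"
    and real: "realisable (Restr r (underS r a))"
  shows "realisable r"
  unfolding realisable_def
proof (intro allI impI; elim conjE)
  fix A X assume A: "large A" and X: "rat_dense X"
  obtain u where u: "u \<in> Field \<kappa>" using infinite_imp_nonempty[OF infinite_Field] by blast
  obtain f D v where st: "stage_at r A X a (Stage f D () v)"
    using ex_stage_above[OF r small real A X u, where 'x = unit] by auto
  then have v: "v \<in> Field \<kappa>" and D: "rat_dense D" by (auto simp: stage_at_def)
  obtain \<nu> where \<nu>: "\<nu> \<in> A" "v \<in> underS \<kappa> \<nu>" "rat_dense (D \<inter> R \<nu>)"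
    using large_nonempty[OF large_dense[OF large_tail[OF A v] D]] by blast
  have Field: "Field r = insert a (underS r a)"
    using a by (auto simp: underS_def FieldI1)
  let ?f = "f(a := \<nu>)"
  have below: "f b \<in> underS \<kappa> \<nu>" if "b \<in> underS r a" for b
    using st that \<nu>(2) underS_trans by (auto simp: stage_at_def)
  have max: "a \<notin> underS r b" for b
    using a(2)[of b] r unfolding order_on_defs antisym_def well_order_on_def underS_def
    by (auto simp: FieldI2)
  have "strictly_increasing r \<kappa> ?f"
    unfolding strictly_increasing_def
  proof (intro conjI allI impI)
    show "?f ` Field r \<subseteq> Field \<kappa>"
      using st \<nu>(1) large_subset[OF A] unfolding Field stage_at_def by auto
    show "?f b \<in> underS \<kappa> (?f c)" if "b \<in> underS r c" for b c
    proof (cases "c = a")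
      case True
      then show ?thesis using below[of b] that max by auto
    next
      case False
      then have "c \<in> underS r a" using that a(2)[of c] by (auto simp: underS_def FieldI2)
      then show ?thesis
        using st that False max
        by (auto simp: stage_at_def strictly_increasing_Restr_underS[OF r])
    qed
  qed
  then show "\<exists>f D. strictly_increasing r \<kappa> f \<and> f ` Field r \<subseteq> A \<and> rat_dense D \<and> D \<subseteq> X \<and>
      (\<forall>a\<in>Field r. D \<subseteq> R (f a))"
    using st \<nu> unfolding Field stage_at_def
    by (intro exI[of _ ?f] exI[of _ "D \<inter> R \<nu>"]) auto
qed

text \<open>
  A fusion argument. Step \<open>n\<close> embeds the initial segment below \<open>k n\<close> above everything before it,
  among those \<open>\<nu>\<close> for which \<open>R \<nu>\<close> contains all points fixed so far, and then fixes a point of the new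
  dense set in the interval number \<open>n\<close>. A fixed point is in \<open>R \<nu>\<close> for later \<open>\<nu>\<close> by this restriction,
  and for earlier \<open>\<nu>\<close> because it belongs to all the earlier dense sets. So all pairs have
  colour 1, without finite exceptions.
\<close>

lemma realisable_of_countable_cofinal:
  fixes k :: "nat \<Rightarrow> 'i"
  assumes r: "Well_order r" and small: "r <o cofinality \<kappa>"
    and cofinal: "\<And>b. b \<in> Field r \<Longrightarrow> \<exists>n. b \<in> underS r (k n)"
    and real: "\<And>n. realisable (Restr r (underS r (k n)))"
  shows "realisable r"
  unfolding realisable_def
proof (intro allI impI; elim conjE)
  fix A X assume A: "large A" and X: "rat_dense X"
  obtain u0 where u0: "u0 \<in> Field \<kappa>" using infinite_imp_nonempty[OF infinite_Field] by blast
  define good where "good n t \<longleftrightarrow> stage_at r A X (k n) t \<and>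
      aux t \<subseteq> X \<and> aux t \<inter> rat_interval n \<noteq> {} \<and> large {\<nu> \<in> A. aux t \<subseteq> R \<nu>} \<and>
      (\<forall>b\<in>underS r (k n). aux t \<subseteq> R (emb t b))" for n and t :: "('i, 'k, rat set) stage"
  define follows where "follows D s u n t \<longleftrightarrow> pts t \<subseteq> D \<and> s \<subseteq> aux t \<and> aux t \<subseteq> s \<union> pts t \<and>
      u \<in> underS \<kappa> (bnd t) \<and> (\<forall>b\<in>underS r (k n). u \<in> underS \<kappa> (emb t b))"
    for D s u n and t :: "('i, 'k, rat set) stage"
  have extend: "\<exists>t. good n t \<and> follows D s u n t"
    if D: "rat_dense D" "D \<subseteq> X" and s: "s \<subseteq> X" "large {\<nu> \<in> A. s \<subseteq> R \<nu>}" and u: "u \<in> Field \<kappa>"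
    for D s u n
  proof -
    obtain f E v where v: "u \<in> underS \<kappa> v" and f: "\<And>b. b \<in> underS r (k n) \<Longrightarrow> u \<in> underS \<kappa> (f b)"
      and st: "\<And>x :: rat set. stage_at r {\<nu> \<in> A. s \<subseteq> R \<nu>} D (k n) (Stage f E x v)"
      using ex_stage_above[OF r small real[of n] s(2) D(1) u, where 'x = "rat set"] by auto
    have E: "rat_dense E" using st by (auto simp: stage_at_def)
    obtain d where d: "d \<in> E" "d \<in> rat_interval n" "large {\<nu> \<in> {\<nu> \<in> A. s \<subseteq> R \<nu>}. d \<in> R \<nu>}"
      using large_point[OF s(2) E] by blast
    have "{\<nu> \<in> A. insert d s \<subseteq> R \<nu>} = {\<nu> \<in> {\<nu> \<in> A. s \<subseteq> R \<nu>}. d \<in> R \<nu>}" by auto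
    with d(3) have "large {\<nu> \<in> A. insert d s \<subseteq> R \<nu>}" by simp
    moreover define t where "t = Stage f E (insert d s) v"
    moreover have "stage_at r A X (k n) t"
      using st[of "insert d s"] D(2) by (auto simp: stage_at_def t_def)
    moreover have "insert d s \<subseteq> X" "insert d s \<inter> rat_interval n \<noteq> {}" "E \<subseteq> D"
      using d s(1) D(2) st by (auto simp: stage_at_def)
    moreover have "insert d s \<subseteq> R (f b)" if "b \<in> underS r (k n)" for b
      using st d(1) that by (auto simp: stage_at_def)
    ultimately have "good n t \<and> follows D s u n t"
      unfolding good_def follows_def t_def using v f d(1) by (simp add: subset_insertI)
    then show ?thesis ..
  qed
  have "\<exists>z. \<forall>n. good n (z n) \<and> follows (pts (z n)) (aux (z n)) (bnd (z n)) (Suc n) (z (Suc n))"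
  proof (rule dependent_nat_choice)
    show "\<exists>t. good 0 t"
      using extend[of X "{}" u0 0] X A u0 by auto
    show "\<exists>t'. good (Suc n) t' \<and> follows (pts t) (aux t) (bnd t) (Suc n) t'" if "good n t" for n t
      using that by (intro extend) (auto simp: good_def stage_at_def)
  qed
  then obtain z where z: "\<And>n. good n (z n)"
    and zs: "\<And>n. follows (pts (z n)) (aux (z n)) (bnd (z n)) (Suc n) (z (Suc n))" by blast
  have later: "aux (z n) \<subseteq> aux (z m) \<and> aux (z m) \<subseteq> aux (z n) \<union> pts (z n) \<and> pts (z m) \<subseteq> pts (z n)"
    if "n \<le> m" for n m
    using that
  proof (induction rule: dec_induct)
    case (step m)
    then show ?case using zs[of m] unfolding follows_def by blast
  qed auto
  have bnd_mono: "bnd (z n) = bnd (z m) \<or> bnd (z n) \<in> underS \<kappa> (bnd (z m))" if "n \<le> m" for n m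
    using that
  proof (induction rule: dec_induct)
    case (step m)
    then show ?case using zs[of m] underS_trans unfolding follows_def by metis
  qed auto
  define D where "D = (\<Union>n. aux (z n))"
  have aux: "aux (z n) \<subseteq> X" "aux (z n) \<inter> rat_interval n \<noteq> {}" for n
    using z[of n] by (simp_all add: good_def)
  have "rat_dense D" using aux(2) unfolding D_def rat_dense_iff by fast
  have "D \<subseteq> X" using aux(1) unfolding D_def by fast
  have D_R: "D \<subseteq> R (emb (z n) b)" if b: "b \<in> underS r (k n)" for n b
  proof
    fix d assume "d \<in> D"
    then obtain m where m: "d \<in> aux (z m)" by (auto simp: D_def)
    then have "d \<in> aux (z n) \<union> pts (z n)"
      using later[of n m] later[of m n] by (cases "n \<le> m") auto
    then show "d \<in> R (emb (z n) b)" using z[of n] b unfolding good_def stage_at_def by blast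
  qed
  have "\<exists>F. strictly_increasing r \<kappa> F \<and>
      (\<forall>b\<in>Field r. \<exists>n\<in>UNIV. b \<in> underS r (k n) \<and> F b = emb (z n) b)"
  proof (rule strictly_increasing_glue[OF r natLeq_Well_order])
    show "UNIV \<subseteq> Field natLeq" by (simp add: Field_natLeq)
    show "\<exists>n\<in>UNIV. b \<in> underS r (k n)" if "b \<in> Field r" for b using cofinal[OF that] by simp
    show "strictly_increasing (Restr r (underS r (k n))) \<kappa> (emb (z n))" for n
      using z[of n] by (simp add: good_def stage_at_def)
    show "emb (z i) b \<in> underS \<kappa> (emb (z j) c)"
      if "i \<in> underS natLeq j" "b \<in> underS r (k i)" "c \<in> underS r (k j)" for i j b c
    proof -
      have "i < j" using that(1) by (auto simp: underS_def natLeq_def)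
      then obtain m where m: "j = Suc m" "i \<le> m" by (metis less_Suc_eq_le lessE)
      have "emb (z i) b \<in> underS \<kappa> (bnd (z i))" using z[of i] that(2) by (auto simp: good_def stage_at_def)
      moreover have "bnd (z m) \<in> underS \<kappa> (emb (z j) c)" using zs[of m] that(3) m by (simp add: follows_def)
      ultimately show ?thesis using bnd_mono[OF m(2)] underS_trans by metis
    qed
  qed
  then obtain F where F: "strictly_increasing r \<kappa> F"
    and Fz: "\<And>b. b \<in> Field r \<Longrightarrow> \<exists>n. b \<in> underS r (k n) \<and> F b = emb (z n) b" by blast
  have "F b \<in> A \<and> D \<subseteq> R (F b)" if b: "b \<in> Field r" for b
  proof -
    obtain n where n: "b \<in> underS r (k n)" "F b = emb (z n) b" using Fz[OF b] by blast
    then show ?thesis using D_R[OF n(1)] z[of n] by (auto simp: good_def stage_at_def)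
  qed
  with F \<open>rat_dense D\<close> \<open>D \<subseteq> X\<close>
  show "\<exists>f D. strictly_increasing r \<kappa> f \<and> f ` Field r \<subseteq> A \<and> rat_dense D \<and> D \<subseteq> X \<and>
      (\<forall>a\<in>Field r. D \<subseteq> R (f a))"
    by (intro exI[of _ F] exI[of _ D]) auto
qed

text \<open>
  Here the block number \<open>a\<close>, for \<open>a\<close> in the field of \<open>r\<close>, is a copy of the initial segment below \<open>a\<close>. The blocks are
  constructed by recursion on \<open>a\<close>, above the bounds of the earlier blocks, inside a dense pseudo-intersection
  of the earlier dense sets. The sparse sets are thinned out at each step to dominate
  the new dense set, so that the next pseudo-intersection exists.
\<close>

lemma realisable_of_uncountable_cofinality:
  fixes r :: "'i rel"
  assumes r: "Well_order r" and small: "r <o cofinality \<kappa>" and tow: "r <o tower_number"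
    and no_max: "\<And>b. b \<in> Field r \<Longrightarrow> \<exists>c. b \<in> underS r c"
    and no_countable: "\<And>K. \<lbrakk>countable K; K \<subseteq> Field r\<rbrakk> \<Longrightarrow> \<exists>b\<in>Field r. \<forall>c\<in>K. b \<notin> underS r c"
    and real: "\<And>a. a \<in> Field r \<Longrightarrow> realisable (Restr r (underS r a))"
  shows "realisable r"
  unfolding realisable_def
proof (intro allI impI; elim conjE)
  fix A X assume A: "large A" and X: "rat_dense X"
  define good where "good h a t \<longleftrightarrow> (a \<in> Field r \<longrightarrow>
      stage_at r A X a t \<and> infinite (aux t) \<and> sparse_for (aux t) (pts t) \<and>
      (\<forall>b\<in>underS r a. finite (pts t - pts (h b)) \<and> finite (aux t - aux (h b)) \<and>
        (\<forall>c\<in>underS r a. bnd (h b) \<in> underS \<kappa> (emb t c))))"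
    for h :: "'i \<Rightarrow> ('i, 'k, nat set) stage" and a t
  have trans: "b \<in> underS r a" if "b \<in> underS r c" "c \<in> underS r a" for a b c
    using that r wo_rel.TRANS[of r] wo_rel.ANTISYM[of r]
    unfolding wo_rel_def underS_def trans_def antisym_def by blast
  have Field: "b \<in> Field r" "c \<in> Field r" if "b \<in> underS r c" for b c
    using that by (auto simp: underS_def FieldI1 FieldI2)
  have "\<exists>h. \<forall>a. good h a (h a)"
  proof (rule dependent_wf_choice)
    show "wf (r - Id)" using r by (simp add: well_order_on_def)
    show "good h a t = good h' a t" if "\<And>b. (b, a) \<in> r - Id \<Longrightarrow> h b = h' b" for h h' a t
    proof -
      have "h b = h' b" if "b \<in> underS r a" for b
        using that \<open>\<And>b. (b, a) \<in> r - Id \<Longrightarrow> h b = h' b\<close> by (auto simp: underS_def)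
      then show ?thesis unfolding good_def by simp
    qed
    show "\<exists>t. good h a t" if below: "\<And>b. (b, a) \<in> r - Id \<Longrightarrow> good h b (h b)" for a h
    proof (cases "a \<in> Field r")
      case False
      then show ?thesis by (simp add: good_def)
    next
      case True
      let ?r = "Restr r (underS r a)"
      have F: "Field ?r = underS r a" by (rule Field_Restr_underS[OF r])
      have h: "good h b (h b)" if "b \<in> underS r a" for b
        using that below by (auto simp: underS_def)
      have "?r <o r" using True r by (intro underS_Restr_ordLess) auto
      then have "?r <o tower_number" using tow ordLess_transitive by blast
      then have "all_towers_extendible ?r" by (rule all_towers_extendible_below_tower_number)
      then have "\<exists>E y. rat_dense E \<and> E \<subseteq> X \<and> infinite y \<and>
          (\<forall>b\<in>Field ?r. finite (E - pts (h b)) \<and> finite (y - aux (h b)))"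
      proof (rule dense_pseudo_intersection_within[OF _ X])
        show "rat_dense (pts (h b)) \<and> pts (h b) \<subseteq> X" if "b \<in> Field ?r" for b
          using h[of b] that Field[of b a] unfolding F good_def stage_at_def by blast
        show "infinite (aux (h b)) \<and> sparse_for (aux (h b)) (pts (h b))" if "b \<in> Field ?r" for b
          using h[of b] that Field[of b a] unfolding F good_def by blast
        show "finite (pts (h c) - pts (h b)) \<and> finite (aux (h c) - aux (h b))"
          if "b \<in> underS ?r c" for b c
        proof -
          have "b \<in> underS r c" "c \<in> underS r a" using that by (auto simp: underS_def)
          then show ?thesis using h[of c] Field[of c a] unfolding good_def by blast
        qed
      qed
      then obtain E y where E: "rat_dense E" "E \<subseteq> X" and y: "infinite y"
        and Ey: "\<And>b. b \<in> underS r a \<Longrightarrow> finite (E - pts (h b)) \<and> finite (y - aux (h b))"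
        unfolding F by auto
      have "(\<lambda>b. bnd (h b)) ` underS r a \<subseteq> Field \<kappa>"
        using h Field by (auto simp: good_def stage_at_def)
      then have "\<exists>u\<in>Field \<kappa>. (\<lambda>b. bnd (h b)) ` underS r a \<subseteq> underS \<kappa> u"
        by (intro bounded_image[OF small]) (auto intro: underS_Field)
      then obtain u where u: "u \<in> Field \<kappa>" "\<And>b. b \<in> underS r a \<Longrightarrow> bnd (h b) \<in> underS \<kappa> u" by blast
      obtain f D v where f: "\<And>b. b \<in> underS r a \<Longrightarrow> u \<in> underS \<kappa> (f b)"
        and st: "\<And>x :: nat set. stage_at r A E a (Stage f D x v)"
        using ex_stage_above[OF r small real[OF True] A E(1) u(1), where 'x = "nat set"] by auto
      have D: "rat_dense D" "D \<subseteq> E" using st by (auto simp: stage_at_def)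
      obtain x where x: "x \<subseteq> y" "infinite x" "sparse_for x D"
        using ex_sparse_subset[OF D(1) y] by blast
      have "finite (D - pts (h b)) \<and> finite (x - aux (h b))" if "b \<in> underS r a" for b
        using Ey[OF that] D(2) x(1) by (meson Diff_mono finite_subset order_refl)
      moreover have "bnd (h b) \<in> underS \<kappa> (f c)" if "b \<in> underS r a" "c \<in> underS r a" for b c
        using u(2)[OF that(1)] f[OF that(2)] by (rule underS_trans)
      moreover have "stage_at r A X a (Stage f D x v)"
        using st[of x] E(2) by (auto simp: stage_at_def)
      ultimately have "good h a (Stage f D x v)"
        using x(2,3) by (simp add: good_def)
      then show ?thesis ..
    qed
  qed
  then obtain h where h: "\<And>a. good h a (h a)" by blast
  have "\<exists>E y. rat_dense E \<and> E \<subseteq> X \<and> infinite y \<and>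
      (\<forall>b\<in>Field r. finite (E - pts (h b)) \<and> finite (y - aux (h b)))"
  proof (rule dense_pseudo_intersection_within[OF _ X])
    show "all_towers_extendible r" by (rule all_towers_extendible_below_tower_number[OF tow])
    show "rat_dense (pts (h b)) \<and> pts (h b) \<subseteq> X" if "b \<in> Field r" for b
      using h[of b] that by (auto simp: good_def stage_at_def)
    show "infinite (aux (h b)) \<and> sparse_for (aux (h b)) (pts (h b))" if "b \<in> Field r" for b
      using h[of b] that by (auto simp: good_def)
    show "finite (pts (h c) - pts (h b)) \<and> finite (aux (h c) - aux (h b))" if "b \<in> underS r c" for b c
      using h[of c] that Field[OF that] by (auto simp: good_def)
  qed
  then obtain E where E: "rat_dense E" "E \<subseteq> X" "\<And>b. b \<in> Field r \<Longrightarrow> finite (E - pts (h b))" by auto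
  define P where "P G = {a \<in> Field r. E - pts (h a) = G}" for G
  \<comment> \<open>Bounds for the countably many sets \<open>P G\<close> would form a countable cofinal set.\<close>
  have "\<exists>G. finite G \<and> (\<forall>b\<in>Field r. \<exists>a\<in>P G. b \<in> underS r a)"
  proof (rule ccontr)
    assume neg: "\<not> ?thesis"
    have "\<exists>c\<in>Field r. \<forall>a\<in>P G. a \<in> underS r c" if G: "finite G" for G
    proof -
      obtain b where b: "b \<in> Field r" "\<And>a. a \<in> P G \<Longrightarrow> b \<notin> underS r a" using neg G by blast
      obtain c where c: "b \<in> underS r c" using no_max[OF b(1)] by blast
      have "a \<in> underS r c" if a: "a \<in> P G" for a
      proof -
        have "a \<in> Field r" using a by (simp add: P_def)
        then have "a = b \<or> a \<in> underS r b"
          using b(1) b(2)[OF a] r wo_rel.TOTALS[of r] unfolding wo_rel_def underS_def by blast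
        then show ?thesis using c trans by blast
      qed
      then show ?thesis using Field[OF c] by blast
    qed
    then obtain c where c: "\<And>G. finite G \<Longrightarrow> c G \<in> Field r \<and> (\<forall>a\<in>P G. a \<in> underS r (c G))" by metis
    have "countable (c ` {G. finite G})"
      by (intro countable_image countable_Collect_finite)
    moreover have "c ` {G. finite G} \<subseteq> Field r" using c by blast
    ultimately obtain b where b: "b \<in> Field r" "\<forall>d\<in>c ` {G. finite G}. b \<notin> underS r d"
      using no_countable by blast
    define G where "G = E - pts (h b)"
    have "finite G" "b \<in> P G" using E(3) b(1) by (auto simp: G_def P_def)
    then show False using c b(2) by blast
  qed
  then obtain G where G: "finite G" and cofinal: "\<And>b. b \<in> Field r \<Longrightarrow> \<exists>a\<in>P G. b \<in> underS r a"
    by blast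
  have stage: "stage_at r A X a (h a)" if "a \<in> P G" for a
    using h[of a] that by (auto simp: good_def P_def)
  have "\<exists>F. strictly_increasing r \<kappa> F \<and> (\<forall>b\<in>Field r. \<exists>a\<in>P G. b \<in> underS r a \<and> F b = emb (h a) b)"
  proof (rule strictly_increasing_glue[OF r r _ cofinal])
    show "P G \<subseteq> Field r" by (auto simp: P_def)
    show "strictly_increasing (Restr r (underS r a)) \<kappa> (emb (h a))" if "a \<in> P G" for a
      using stage[OF that] by (simp add: stage_at_def)
    show "emb (h i) b \<in> underS \<kappa> (emb (h j) c)"
      if "i \<in> P G" "i \<in> underS r j" "b \<in> underS r i" "c \<in> underS r j" for i j b c
    proof (rule underS_trans)
      show "emb (h i) b \<in> underS \<kappa> (bnd (h i))"
        using stage[OF that(1)] that(3) by (auto simp: stage_at_def)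
      show "bnd (h i) \<in> underS \<kappa> (emb (h j) c)"
        using h[of j] that(2,4) Field[OF that(2)] by (auto simp: good_def)
    qed
  qed
  then obtain F where F: "strictly_increasing r \<kappa> F"
    and Fh: "\<And>b. b \<in> Field r \<Longrightarrow> \<exists>a\<in>P G. b \<in> underS r a \<and> F b = emb (h a) b" by blast
  have FA: "F b \<in> A \<and> E - G \<subseteq> R (F b)" if b: "b \<in> Field r" for b
  proof -
    obtain a where a: "a \<in> P G" "b \<in> underS r a" "F b = emb (h a) b" using Fh[OF b] by blast
    have "E - G \<subseteq> pts (h a)" using a(1) by (auto simp: P_def)
    then show ?thesis using stage[OF a(1)] a(2,3) unfolding stage_at_def by fastforce
  qed
  have "rat_dense (E - G)" by (rule rat_dense_Diff_finite[OF E(1) G])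
  then show "\<exists>f D. strictly_increasing r \<kappa> f \<and> f ` Field r \<subseteq> A \<and> rat_dense D \<and> D \<subseteq> X \<and>
      (\<forall>a\<in>Field r. D \<subseteq> R (f a))"
    using F FA E(2) by (intro exI[of _ F] exI[of _ "E - G"]) auto
qed

theorem realisable_below:
  assumes "Well_order r" and "r <o cofinality \<kappa>" and "r <o tower_number"
  shows "realisable r"
  using assms
proof (induction r rule: wf_induct_rule[OF wf_ordLess])
  case (1 r)
  note r = 1(2) and small = 1(3) and tow = 1(4)
  have real: "realisable (Restr r (underS r a))" if "a \<in> Field r" for a
  proof -
    have less: "Restr r (underS r a) <o r" using r that by (intro underS_Restr_ordLess) auto
    show ?thesis
      using less ordLess_transitive[OF less small] ordLess_transitive[OF less tow] Well_order_Restr[OF r]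
      by (intro 1(1)) auto
  qed
  show ?case
  proof (cases "\<exists>a\<in>Field r. \<forall>b\<in>Field r. (b, a) \<in> r")
    case True
    then show ?thesis using realisable_of_maximum[OF r small] real by blast
  next
    case no_max: False
    have ex_above: "\<exists>c. b \<in> underS r c" if b: "b \<in> Field r" for b
    proof -
      obtain c where "c \<in> Field r" "(c, b) \<notin> r" using no_max b by blast
      then have "b \<in> underS r c"
        using b r wo_rel.TOTALS[of r] unfolding wo_rel_def underS_def by blast
      then show ?thesis ..
    qed
    show ?thesis
    proof (cases "\<exists>K. countable K \<and> K \<subseteq> Field r \<and> (\<forall>b\<in>Field r. \<exists>c\<in>K. b \<in> underS r c)")
      case True
      then obtain K where K: "countable K" "K \<subseteq> Field r" "\<And>b. b \<in> Field r \<Longrightarrow> \<exists>c\<in>K. b \<in> underS r c"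
        by blast
      show ?thesis
      proof (cases "K = {}")
        case True
        then have "Field r = {}" using K(3) by blast
        then show ?thesis
          unfolding realisable_def strictly_increasing_def underS_def by (auto simp: Field_def)
      next
        case False
        then have range: "range (from_nat_into K) = K" using K(1) by (rule range_from_nat_into)
        show ?thesis
        proof (rule realisable_of_countable_cofinal[OF r small])
          show "\<exists>n. b \<in> underS r (from_nat_into K n)" if "b \<in> Field r" for b
            using K(3)[OF that] range by (metis imageE)
          show "realisable (Restr r (underS r (from_nat_into K n)))" for n
            using real K(2) range by blast
        qed
      qed
    next
      case False
      show ?thesis
      proof (rule realisable_of_uncountable_cofinality[OF r small tow])
        show "\<exists>c. b \<in> underS r c" if "b \<in> Field r" for b using that by (rule ex_above)
        show "realisable (Restr r (underS r a))" if "a \<in> Field r" for a using that by (rule real)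
        show "\<exists>b\<in>Field r. \<forall>c\<in>K. b \<notin> underS r c" if "countable K" "K \<subseteq> Field r" for K
          using False that by simp
      qed
    qed
  qed
qed

end

section \<open>The polarised partition relation\<close>

lemma (in uncountable_cofinality) ex_homogeneous:
  fixes R :: "'k \<Rightarrow> rat set"
  assumes "Well_order r" and "r <o cofinality \<kappa>" and "r <o tower_number"
  shows "(\<exists>g (e :: rat \<Rightarrow> rat). strictly_increasing \<kappa> \<kappa> g \<and> strict_mono e \<and> (\<forall>\<nu>\<in>Field \<kappa>. \<forall>q. e q \<notin> R (g \<nu>))) \<or>
    (\<exists>f (e :: rat \<Rightarrow> rat). strictly_increasing r \<kappa> f \<and> strict_mono e \<and> (\<forall>a\<in>Field r. \<forall>q. e q \<in> R (f a)))"
proof (cases "no_large_homogeneous \<kappa> R")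
  case True
  then interpret no_large_homogeneous \<kappa> R .
  have "rat_dense UNIV" by (simp add: rat_dense_def dense)
  from realisableD[OF realisable_below[OF assms] large_Field this]
  obtain f D where f: "strictly_increasing r \<kappa> f" "\<forall>a\<in>Field r. D \<subseteq> R (f a)"
    and D: "rat_dense D" by blast
  have "\<exists>e :: rat \<Rightarrow> rat. strict_mono e \<and> range e \<subseteq> D"
    using D by (intro ex_strict_mono_into_dense[of 0 1]) (simp_all add: rat_dense_def)
  then obtain e :: "rat \<Rightarrow> rat" where e: "strict_mono e" "range e \<subseteq> D" by blast
  have "e q \<in> R (f a)" if "a \<in> Field r" for a q
  proof -
    have "D \<subseteq> R (f a)" using f(2) that by simp
    then show ?thesis using e(2) by auto
  qed
  with f(1) e(1) show ?thesis by (intro disjI2 exI[of _ f] exI[of _ e]) simp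
next
  case False
  then obtain X where X: "rat_dense X" and bad: "large {\<nu> \<in> Field \<kappa>. \<not> rat_dense (X \<inter> R \<nu>)}"
    using uncountable_cofinality_axioms
    by (auto simp: no_large_homogeneous_def no_large_homogeneous_axioms_def)
  let ?N = "{\<nu> \<in> Field \<kappa>. \<not> rat_dense (X \<inter> R \<nu>)}"
  have "\<exists>n\<in>UNIV. large (?N \<inter> {\<nu>. X \<inter> R \<nu> \<inter> rat_interval n = {}})"
    using bad by (intro large_countable_cover) (auto simp: rat_dense_iff)
  then obtain n where n: "large (?N \<inter> {\<nu>. X \<inter> R \<nu> \<inter> rat_interval n = {}})" by blast
  have "rat_interval n \<in> {{a<..<b} | a b. a < b}"
    unfolding range_rat_interval[symmetric] by (rule rangeI)
  then obtain a b where ab: "rat_interval n = {a<..<b}" "a < b" by auto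
  have "\<exists>x\<in>X \<inter> rat_interval n. l < x \<and> x < u" if "a \<le> l" "l < u" "u \<le> b" for l u
  proof -
    obtain x where "x \<in> X" "l < x" "x < u" using X \<open>l < u\<close> unfolding rat_dense_def by blast
    then show ?thesis using that ab(1) by (intro bexI[of _ x]) auto
  qed
  then have "\<exists>e :: rat \<Rightarrow> rat. strict_mono e \<and> range e \<subseteq> X \<inter> rat_interval n"
    using ab(2) by (intro ex_strict_mono_into_dense[of a b]) simp_all
  then obtain e :: "rat \<Rightarrow> rat" where e: "strict_mono e" "range e \<subseteq> X \<inter> rat_interval n" by blast
  obtain g where g: "strictly_increasing \<kappa> \<kappa> g"
    and gN: "g ` Field \<kappa> \<subseteq> ?N \<inter> {\<nu>. X \<inter> R \<nu> \<inter> rat_interval n = {}}"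
    using large_has_full_type[OF n] by auto
  have "e q \<notin> R (g \<nu>)" if "\<nu> \<in> Field \<kappa>" for \<nu> q
  proof -
    have "X \<inter> R (g \<nu>) \<inter> rat_interval n = {}" using gN that by blast
    moreover have "e q \<in> X \<inter> rat_interval n" using e(2) by blast
    ultimately show ?thesis by blast
  qed
  with g e(1) show ?thesis by (intro disjI1 exI[of _ g] exI[of _ e]) simp
qed

theorem theorem6p7:
  fixes \<kappa> :: "'k rel" and \<alpha> :: "'i rel"
  assumes "Card_order \<kappa>"
    and "\<kappa> \<le>o ctwo ^c natLeq"
    and "natLeq <o cofinality \<kappa>"
    and "Well_order \<alpha>"
    and "\<alpha> <o tower_number"
    and "\<alpha> <o cofinality \<kappa>"
  shows "polarised_partition TYPE('a) TYPE('b) \<kappa> eta \<kappa> eta \<alpha> eta"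
  unfolding polarised_partition_def
proof (intro allI impI; elim conjE)
  fix A :: "'a rel" and B :: "'b rel" and c :: "'a \<times> 'b \<Rightarrow> nat"
  assume A: "Linear_order A" "same_order_type A \<kappa>" and B: "Linear_order B" "same_order_type B eta"
    and c: "c ` (Field A \<times> Field B) \<subseteq> {0, 1}"
  interpret uncountable_cofinality \<kappa> by unfold_locales (fact assms)+
  obtain p where p: "strictly_increasing \<kappa> A p"
    using A(2) iso_inverse_strictly_increasing unfolding same_order_type_def by blast
  obtain h where h: "strictly_increasing eta B h"
    using B(2) iso_inverse_strictly_increasing unfolding same_order_type_def by blast
  have lin: "Linear_order \<kappa>" "Linear_order \<alpha>"
    using well assms(4) by (auto simp: well_order_on_def)
  define R where "R \<nu> = {q. c (p \<nu>, h q) = 1}" for \<nu>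
  have c01: "c (p \<nu>, h q) \<in> {0, 1}" if "\<nu> \<in> Field \<kappa>" for \<nu> q
    using c p h that by (auto simp: strictly_increasing_def image_subset_iff)
  have cols: "suborder_of_type B ((h \<circ> e) ` Field eta) eta" if "strict_mono e"
    for e :: "rat \<Rightarrow> rat"
    using that by (intro suborder_of_type_image B Linear_order_eta strictly_increasing_comp[OF _ h])
      (simp add: strictly_increasing_eta)
  from ex_homogeneous[OF assms(4,6,5), of R]
  show "(\<exists>C D. suborder_of_type A C \<kappa> \<and> suborder_of_type B D eta \<and> c ` (C \<times> D) \<subseteq> {0}) \<or>
    (\<exists>E Z. suborder_of_type A E \<alpha> \<and> suborder_of_type B Z eta \<and> c ` (E \<times> Z) \<subseteq> {1})"
  proof (elim disjE exE conjE)
    fix g and e :: "rat \<Rightarrow> rat" assume g: "strictly_increasing \<kappa> \<kappa> g" and e: "strict_mono e"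
      and R: "\<forall>\<nu>\<in>Field \<kappa>. \<forall>q. e q \<notin> R (g \<nu>)"
    have "c (p (g \<nu>), h (e q)) = 0" if "\<nu> \<in> Field \<kappa>" for \<nu> q
    proof -
      have "g \<nu> \<in> Field \<kappa>" using g that by (auto simp: strictly_increasing_def)
      then show ?thesis using c01[of "g \<nu>" "e q"] R that by (simp add: R_def)
    qed
    then have "c ` ((p \<circ> g) ` Field \<kappa> \<times> (h \<circ> e) ` Field eta) \<subseteq> {0}" by auto
    then show ?thesis
      using cols[OF e] suborder_of_type_image[OF A(1) lin(1) strictly_increasing_comp[OF g p]] by blast
  next
    fix f and e :: "rat \<Rightarrow> rat" assume f: "strictly_increasing \<alpha> \<kappa> f" and e: "strict_mono e"
      and R: "\<forall>a\<in>Field \<alpha>. \<forall>q. e q \<in> R (f a)"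
    have "c ` ((p \<circ> f) ` Field \<alpha> \<times> (h \<circ> e) ` Field eta) \<subseteq> {1}"
      using R by (auto simp: R_def)
    then show ?thesis
      using cols[OF e] suborder_of_type_image[OF A(1) lin(2) strictly_increasing_comp[OF f p]] by blast
  qed
qed

end
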